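(* Let $d \ge 1$ be an integer. The class of $d$-dimensional ellipsoids has VC dimension exactly $(d^2+3d)/2$.
   Context: A $d$-dimensional ellipsoid is an open set of the form $\{x \in \mathbb{R}^d : {}^t(x-\mu) A (x-\mu) < 1\}$, where $\mu \in \mathbb{R}^d$ and $A \in \mathbb{R}^{d\times d}$ is a (symmetric) positive definite matrix. For $X \subseteq \mathbb{R}^d$ and $Y \subseteq X$, a set $B$ cuts $Y$ out of $X$ if $Y = X \cap B$. A class $\mathcal{C}$ of subsets of $\mathbb{R}^d$ shatters $X$ if every $Y \subseteq X$ is cut out of $X$ by some $B \in \mathcal{C}$. The VC dimension of $\mathcal{C}$ is the maximum $n$ (or $\infty$ if no maximum exists) such that some subset of $\mathbb{R}^d$ of cardinality $n$ is shattered by $\mathcal{C}$. *)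

theory Defs
  imports "HOL-Analysis.Analysis" "HOL-Library.Extended_Nat"
begin

definition positive_definite :: "real^'n^'n \<Rightarrow> bool" where
  "positive_definite A \<longleftrightarrow> transpose A = A \<and> (\<forall>v. v \<noteq> 0 \<longrightarrow> v \<bullet> (A *v v) > 0)"

definition ellipsoid :: "real^'n \<Rightarrow> real^'n^'n \<Rightarrow> (real^'n) set" where
  "ellipsoid \<mu> A = {x. (x - \<mu>) \<bullet> (A *v (x - \<mu>)) < 1}"

definition ellipsoids :: "(real^'n) set set" where
  "ellipsoids = {ellipsoid \<mu> A | \<mu> A. positive_definite A}"

definition cuts_out :: "'a set \<Rightarrow> 'a set \<Rightarrow> 'a set \<Rightarrow> bool" where
  "cuts_out B Y X \<longleftrightarrow> Y = X \<inter> B"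

definition shatters :: "'a set set \<Rightarrow> 'a set \<Rightarrow> bool" where
  "shatters C X \<longleftrightarrow> (\<forall>Y\<subseteq>X. \<exists>B\<in>C. cuts_out B Y X)"

definition shattered_cards :: "'a set set \<Rightarrow> nat set" where
  "shattered_cards C = {n. \<exists>X. finite X \<and> card X = n \<and> shatters C X}"

(* For C = {} no set at all is shattered, so there is no maximum and the value is \<infinity>. *)
definition vc_dim :: "'a set set \<Rightarrow> enat" where
  "vc_dim C =
     (if \<exists>n\<in>shattered_cards C. \<forall>m\<in>shattered_cards C. m \<le> n
      then enat (GREATEST n. n \<in> shattered_cards C) else \<infinity>)"

end

theory Submission
  imports Defs
begin

text \<open>
  Write an ellipsoid as the negativity set of a quadratic polynomial \<open>f\<close>; these polynomials form
  a space of dimension \<open>N + 1\<close>, where \<open>N = (d^2 + 3 d) / 2\<close>.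

  Upper bound: the evaluations at \<open>N + 1\<close> points, together with the functional that takes the
  trace of the quadratic part, are linearly dependent. The trace is positive on every ellipsoid,
  so a linear relation prescribes a sign pattern on the points which no ellipsoid realises.

  Lower bound: take the \<open>N\<close> points \<open>e\<^sub>i\<close>, \<open>-e\<^sub>i\<close> and \<open>(e\<^sub>i + e\<^sub>j) / sqrt 2\<close> on the unit sphere.
  Quadratic polynomials \<open>g\<close> without constant term interpolate arbitrary values there, and for
  small \<open>\<epsilon> > 0\<close> the polynomial \<open>|x|^2 - 1 + \<epsilon> g\<close> still defines an ellipsoid, while its signs on
  the points are those of \<open>g\<close>.
\<close>

section \<open>The upper bound\<close>

text \<open>The affine Veronese map: a quadratic polynomial takes at \<open>x\<close> the value of
  the inner product of its coefficient triple with \<open>veronese x\<close>.\<close>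

definition veronese :: "real^'n \<Rightarrow> (real^'n^'n) \<times> (real^'n) \<times> real" where
  "veronese x = ((\<chi> i j. x $ i * x $ j), x, 1)"

text \<open>Indexing by a set makes the matrix symmetric: a singleton gives a diagonal matrix unit,
  a doubleton the sum of a matrix unit and its transpose.\<close>

definition pair_matrix :: "'n set \<Rightarrow> real^'n^'n" where
  "pair_matrix S = (\<chi> i j. if {i, j} = S then 1 else 0)"

definition quadratic_generators :: "((real^'n^'n) \<times> (real^'n) \<times> real) set" where
  "quadratic_generators =
     (\<lambda>S. (pair_matrix S, 0, 0)) ` {S. card S = 1 \<or> card S = 2}
     \<union> range (\<lambda>i. (0, axis i 1, 0)) \<union> {(0, 0, 1)}"

lemma card_two_subsets: "card {S :: 'n::finite set. card S = 2} = CARD('n) choose 2"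
  using n_subsets[of "UNIV :: 'n set" 2] by simp

lemma card_one_subsets: "card {S :: 'n::finite set. card S = Suc 0} = CARD('n)"
  using n_subsets[of "UNIV :: 'n set" 1] by simp

text \<open>The numerator is even, so \<open>div\<close> loses nothing. The right side is the form
  in which both bounds are counted.\<close>

lemma vc_formula: "((n::nat)^2 + 3 * n) div 2 = (n choose 2) + 2 * n"
proof -
  have "n^2 + 3 * n = n * (n - 1) + (2 * n) * 2"
    by (cases n) (auto simp: power2_eq_square)
  then show ?thesis by (simp add: choose_two)
qed

lemma finite_quadratic_generators: "finite (quadratic_generators :: ((real^'n^'n) \<times> _) set)"
  by (simp add: quadratic_generators_def)

lemma card_quadratic_generators:
  "card (quadratic_generators :: ((real^'n^'n) \<times> _) set)
     \<le> (CARD('n) choose 2) + 2 * CARD('n) + 1"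
proof -
  let ?P = "{S :: 'n set. card S = 1 \<or> card S = 2}"
  have "?P = {S. card S = 1} \<union> {S. card S = 2}" by auto
  then have "card ?P \<le> CARD('n) + (CARD('n) choose 2)"
    using card_Un_le[of "{S :: 'n set. card S = 1}" "{S. card S = 2}"]
    by (simp add: card_one_subsets card_two_subsets)
  moreover have "card ((\<lambda>S :: 'n set. (pair_matrix S, 0 :: real^'n, 0 :: real)) ` ?P) \<le> card ?P"
    by (rule card_image_le) simp
  moreover have "card (range (\<lambda>i :: 'n. (0 :: real^'n^'n, axis i 1 :: real^'n, 0 :: real)))
      \<le> CARD('n)"
    by (rule card_image_le) simp
  ultimately show ?thesis
    unfolding quadratic_generators_def
    by (intro card_Un_le[THEN order_trans]) (use card_Un_le[of
      "(\<lambda>S :: 'n set. (pair_matrix S, 0 :: real^'n, 0 :: real)) ` ?P"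
      "range (\<lambda>i :: 'n. (0 :: real^'n^'n, axis i 1 :: real^'n, 0 :: real))"] in simp)
qed

lemma symmetric_eq_sum_pair_matrix:
  fixes M :: "real^'n^'n"
  assumes "transpose M = M"
  obtains c where "M = (\<Sum>S | card S = 1 \<or> card S = 2. c S *\<^sub>R pair_matrix S)"
proof
  \<comment> \<open>Symmetry of \<open>M\<close> makes the entry depend only on the set of its two
    indices, so \<open>THE\<close> is well defined on \<open>{i, j}\<close>.\<close>
  let ?c = "\<lambda>S. THE r. \<exists>i j. S = {i, j} \<and> r = M $ i $ j"
  have sym: "M $ i $ j = M $ j $ i" for i j
    using assms by (metis transpose_def vec_lambda_beta)
  have c: "?c {i, j} = M $ i $ j" for i j
    by (rule the_equality) (use sym in \<open>auto simp: doubleton_eq_iff\<close>)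
  have P: "card {i, j} = 1 \<or> card {i, j} = 2" for i j :: 'n
    by (cases "i = j") auto
  show "M = (\<Sum>S | card S = 1 \<or> card S = 2. ?c S *\<^sub>R pair_matrix S)"
    using P by (simp add: vec_eq_iff pair_matrix_def c if_distrib[of "\<lambda>x. _ * x"] cong: if_cong)
qed

lemma symmetric_in_span_generators:
  fixes M :: "real^'n^'n" and b :: "real^'n" and r :: real
  assumes "transpose M = M"
  shows "(M, b, r) \<in> span quadratic_generators"
proof -
  obtain c where c: "M = (\<Sum>S | card S = 1 \<or> card S = 2. c S *\<^sub>R pair_matrix S)"
    using symmetric_eq_sum_pair_matrix[OF assms] by blast
  have "(\<Sum>S | card S = 1 \<or> card S = 2. c S *\<^sub>R (pair_matrix S, 0 :: real^'n, 0 :: real))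
      \<in> span quadratic_generators"
    by (intro span_sum span_scale span_base) (auto simp: quadratic_generators_def)
  moreover have "(\<Sum>S | card S = 1 \<or> card S = 2. c S *\<^sub>R (pair_matrix S, 0 :: real^'n, 0 :: real))
      = (M, 0, 0)"
    by (subst c) (simp add: prod_eq_iff fst_sum snd_sum)
  moreover have "(\<Sum>i\<in>UNIV. b $ i *\<^sub>R (0 :: real^'n^'n, axis i 1 :: real^'n, 0 :: real))
      \<in> span quadratic_generators"
    by (intro span_sum span_scale span_base) (auto simp: quadratic_generators_def)
  moreover have "(\<Sum>i\<in>UNIV. b $ i *\<^sub>R (0 :: real^'n^'n, axis i 1 :: real^'n, 0 :: real)) = (0, b, 0)"
    using basis_expansion[of b] by (simp add: prod_eq_iff fst_sum snd_sum scalar_mult_eq_scaleR)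
  moreover have "r *\<^sub>R (0 :: real^'n^'n, 0 :: real^'n, 1) \<in> span quadratic_generators"
    by (intro span_scale span_base) (auto simp: quadratic_generators_def)
  ultimately have "(M, 0, 0) + (0, b, 0) + (0, 0, r) \<in> span quadratic_generators"
    by (intro span_add) auto
  then show ?thesis by simp
qed

section \<open>Sign patterns that ellipsoids cannot realise\<close>

lemma ellipsoid_functional:
  fixes A :: "real^'n^'n"
  assumes "positive_definite A"
  obtains w where "\<And>x. x \<in> ellipsoid \<mu> A \<longleftrightarrow> w \<bullet> veronese x < 0"
    and "w \<bullet> (mat 1, 0, 0) > 0"
proof
  \<comment> \<open>Coefficients of the expanded polynomial
    \<open>(x - \<mu>) \<bullet> (A *v (x - \<mu>)) - 1\<close>. Pairing them with
    \<open>(mat 1, 0, 0)\<close> gives the trace of \<open>A\<close>.\<close>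
  let ?w = "(A, - 2 *\<^sub>R (A *v \<mu>), \<mu> \<bullet> (A *v \<mu>) - 1)"
  have sym: "x \<bullet> (A *v y) = y \<bullet> (A *v x)" for x y
    using assms by (metis positive_definite_def dot_lmul_matrix inner_commute transpose_matrix_vector)
  have "A \<bullet> (\<chi> i j. x $ i * x $ j) = x \<bullet> (A *v x)" for x
    by (simp add: inner_vec_def matrix_vector_mult_def sum_distrib_left mult_ac)
  then show "x \<in> ellipsoid \<mu> A \<longleftrightarrow> ?w \<bullet> veronese x < 0" for x
    using sym[of x \<mu>] inner_commute[of "A *v \<mu>" x]
    by (simp add: ellipsoid_def veronese_def algebra_simps)
  have "A $ i $ i > 0" for i
  proof -
    have "axis i 1 \<bullet> (A *v axis i 1) > 0"
      using assms by (simp add: positive_definite_def)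
    then show ?thesis
      by (simp add: inner_axis' matrix_vector_mult_basis column_def)
  qed
  then have "(\<Sum>i\<in>UNIV. A $ i $ i) > 0" by (intro sum_pos) auto
  moreover have "A \<bullet> mat 1 = (\<Sum>i\<in>UNIV. A $ i $ i)"
    by (simp add: inner_vec_def mat_def if_distrib[of "\<lambda>x. _ * x"] cong: if_cong)
  ultimately show "?w \<bullet> (mat 1, 0, 0) > 0" by simp
qed

text \<open>An ellipsoid cutting out the points with \<open>c x \<ge> 0\<close> makes every term
  \<open>c x * (w \<bullet> veronese x)\<close> nonpositive, while the relation evaluates their sum
  to \<open>k\<close> times a positive trace. For \<open>k = 0\<close> a strictly negative term is
  needed. Only \<open>c x > 0\<close> guarantees one, since outside the open ellipsoid the
  polynomial may vanish.\<close>

lemma shatters_ellipsoids_imp_no_relation: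
  fixes X :: "(real^'n) set"
  assumes fin: "finite X" and sh: "shatters ellipsoids X"
    and rel: "(\<Sum>x\<in>X. c x *\<^sub>R veronese x) = k *\<^sub>R (mat 1, 0, 0)"
    and pos: "k > 0 \<or> k = 0 \<and> (\<exists>x\<in>X. c x > 0)"
  shows False
proof -
  let ?Y = "{x \<in> X. c x \<ge> 0}"
  have "\<exists>B\<in>ellipsoids. cuts_out B ?Y X"
    using sh unfolding shatters_def by simp
  then obtain \<mu> A where A: "positive_definite A" and Y: "?Y = X \<inter> ellipsoid \<mu> A"
    unfolding cuts_out_def ellipsoids_def by blast
  obtain w where w: "\<And>x. x \<in> ellipsoid \<mu> A \<longleftrightarrow> w \<bullet> veronese x < 0"
    and tr: "w \<bullet> (mat 1, 0, 0) > 0"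
    using ellipsoid_functional[OF A] by blast
  have sgn: "c x \<ge> 0 \<longleftrightarrow> w \<bullet> veronese x < 0" if "x \<in> X" for x
    using that Y w by blast
  have nonpos: "c x * (w \<bullet> veronese x) \<le> 0" if "x \<in> X" for x
    using sgn[OF that] by (auto simp: mult_le_0_iff)
  have eq: "(\<Sum>x\<in>X. c x * (w \<bullet> veronese x)) = k * (w \<bullet> (mat 1, 0, 0))"
    using arg_cong[OF rel, of "\<lambda>v. w \<bullet> v"] by (simp only: inner_sum_right inner_scaleR_right)
  have le: "(\<Sum>x\<in>X. c x * (w \<bullet> veronese x)) \<le> 0"
    by (rule sum_nonpos) (rule nonpos)
  from pos show False
  proof
    assume "k > 0"
    then show False using le eq tr mult_pos_pos by (metis not_less)
  next
    assume "k = 0 \<and> (\<exists>x\<in>X. c x > 0)"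
    then obtain x where x: "k = 0" "x \<in> X" "c x > 0" by blast
    then have "c x * (w \<bullet> veronese x) < 0"
      using sgn[of x] by (auto simp: mult_less_0_iff)
    then have "(\<Sum>x\<in>X. c x * (w \<bullet> veronese x)) < (\<Sum>x\<in>X. 0)"
      using x nonpos by (intro sum_strict_mono_ex1[OF fin]) auto
    with eq x show False by simp
  qed
qed

text \<open>With one point too many, the Veronese vectors and the trace vector outnumber the
  generators of a space containing them all, and the resulting linear relation contradicts
  shattering.\<close>

lemma card_shattered_by_ellipsoids_le:
  fixes X :: "(real^'n) set"
  assumes fin: "finite X" and sh: "shatters ellipsoids X"
  shows "card X \<le> (CARD('n) choose 2) + 2 * CARD('n)"
proof (rule ccontr)
  let ?t = "(mat 1, 0, 0) :: (real^'n^'n) \<times> (real^'n) \<times> real"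
  let ?Z = "insert ?t (veronese ` X)"
  assume "\<not> ?thesis"
  moreover have inj: "inj_on veronese X"
    by (auto simp: inj_on_def veronese_def)
  \<comment> \<open>The last coordinates are 0 and 1, so the trace vector really adds one to the
    cardinality.\<close>
  moreover have tnot: "?t \<notin> veronese ` X"
    by (auto simp: veronese_def)
  ultimately have "card ?Z > card (quadratic_generators :: ((real^'n^'n) \<times> _) set)"
    using card_quadratic_generators[where 'n = 'n] fin by (simp add: card_image)
  moreover have "?Z \<subseteq> span quadratic_generators"
    by (auto simp: veronese_def transpose_def vec_eq_iff mat_def mult.commute
        intro!: symmetric_in_span_generators)
  ultimately have "dependent ?Z"
    using independent_span_bound[OF finite_quadratic_generators] by (meson leD)
  then obtain u where u: "\<exists>v\<in>?Z. u v \<noteq> 0" "(\<Sum>v\<in>?Z. u v *\<^sub>R v) = 0"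
    using fin by (auto simp: dependent_finite)
  then have sum: "u ?t *\<^sub>R ?t + (\<Sum>x\<in>X. u (veronese x) *\<^sub>R veronese x) = 0"
    using fin tnot by (simp add: sum.reindex[OF inj])
  \<comment> \<open>The relation may be negated: choosing \<open>s\<close> as 1 or -1 makes the
    coefficient of \<open>?t\<close> on the right positive or, if it vanishes, some coefficient on
    the left positive.\<close>
  have rel: "(\<Sum>x\<in>X. (s * u (veronese x)) *\<^sub>R veronese x) = (- s * u ?t) *\<^sub>R ?t" for s
  proof -
    have "(\<Sum>x\<in>X. u (veronese x) *\<^sub>R veronese x) = - (u ?t *\<^sub>R ?t)"
      using sum by (simp only: add_eq_0_iff)
    then have "s *\<^sub>R (\<Sum>x\<in>X. u (veronese x) *\<^sub>R veronese x) = (- s * u ?t) *\<^sub>R ?t"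
      by (simp only: scaleR_minus_right scaleR_scaleR mult_minus_left scaleR_minus_left)
    then show ?thesis
      by (simp only: scaleR_sum_right scaleR_scaleR)
  qed
  consider "u ?t < 0" | "u ?t > 0" | x where "u ?t = 0" "x \<in> X" "u (veronese x) > 0"
    | x where "u ?t = 0" "x \<in> X" "u (veronese x) < 0"
    using u(1) by fastforce
  then show False
    by cases (use shatters_ellipsoids_imp_no_relation[OF fin sh rel[of 1]]
        shatters_ellipsoids_imp_no_relation[OF fin sh rel[of "-1"]] in force)+
qed

section \<open>The lower bound\<close>

text \<open>The factor \<open>1 / sqrt 2\<close> gives norm 1 for doubletons. Sets as indices count
  each unordered pair once.\<close>

definition pair_point :: "'n set \<Rightarrow> real^'n" where
  "pair_point S = (\<chi> i. if i \<in> S then 1 / sqrt 2 else 0)"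

definition sphere_points :: "(real^'n) set" where
  "sphere_points = range (\<lambda>i. axis i 1) \<union> range (\<lambda>i. axis i (-1)) \<union> pair_point ` {S. card S = 2}"

lemma pair_point_doubleton:
  assumes "i \<noteq> j"
  shows "pair_point {i, j} = (1 / sqrt 2) *\<^sub>R (axis i 1 + axis j 1)"
  using assms by (auto simp: pair_point_def vec_eq_iff axis_def)

lemma finite_sphere_points: "finite (sphere_points :: (real^'n) set)"
  by (simp add: sphere_points_def)

lemma card_sphere_points:
  "card (sphere_points :: (real^'n) set) = (CARD('n) choose 2) + 2 * CARD('n)"
proof -
  let ?P = "range (\<lambda>i. axis i 1) :: (real^'n) set"
  let ?M = "range (\<lambda>i. axis i (-1)) :: (real^'n) set"
  let ?Q = "pair_point ` {S. card S = 2} :: (real^'n) set"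
  have "card ?P = CARD('n)" "card ?M = CARD('n)"
    by (simp_all add: card_image inj_on_def axis_eq_axis)
  moreover have "inj_on (pair_point :: 'n set \<Rightarrow> _) {S. card S = 2}"
  proof (rule inj_onI)
    fix S T :: "'n set"
    assume "pair_point S = pair_point T"
    then have "(if i \<in> S then 1 / sqrt 2 else 0) = (if i \<in> T then 1 / sqrt 2 else (0::real))" for i
      unfolding pair_point_def vec_eq_iff by simp
    then have "i \<in> S \<longleftrightarrow> i \<in> T" for i
      by (metis divide_eq_0_iff one_neq_zero real_sqrt_eq_zero_cancel_iff zero_neq_numeral)
    then show "S = T" by blast
  qed
  then have "card ?Q = CARD('n) choose 2"
    by (simp add: card_image card_two_subsets)
  moreover have "?P \<inter> ?M = {}"
    by (auto simp: axis_eq_axis)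
  moreover have "(?P \<union> ?M) \<inter> ?Q = {}"
  proof -
    \<comment> \<open>Coordinate \<open>k\<close> has square 1 on the left, but 0 or 1/2 on the
      right.\<close>
    have "axis k r \<noteq> pair_point S" if "card S = 2" "r = 1 \<or> r = -1" for k :: 'n and S r
    proof
      assume "axis k r = pair_point S"
      then have "axis k r $ k = pair_point S $ k" by simp
      with that(2) have "r = 1 / sqrt 2" by (auto simp: pair_point_def split: if_splits)
      then have "r\<^sup>2 = 1 / 2" by (simp add: power_divide)
      with that(2) show False by auto
    qed
    then have "axis k 1 \<noteq> pair_point S" "axis k (-1) \<noteq> pair_point S" if "card S = 2" for k :: 'n and S
      using that by simp_all
    then show ?thesis by (fastforce dest: sym)
  qed
  ultimately show ?thesis
    unfolding sphere_points_def by (subst card_Un_disjoint; simp add: card_Un_disjoint)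
qed

lemma sphere_points_cases:
  assumes "x \<in> sphere_points"
  obtains i where "x = axis i 1" | i where "x = axis i (-1)"
    | i j where "i \<noteq> j" "x = pair_point {i, j}"
proof -
  from assms consider "\<exists>i. x = axis i 1" | "\<exists>i. x = axis i (-1)"
    | S where "card S = 2" "x = pair_point S"
    unfolding sphere_points_def by blast
  then show ?thesis
  proof cases
    case (3 S)
    then obtain i j where "S = {i, j}" "i \<noteq> j" unfolding card_2_iff by blast
    with 3(2) that(3) show ?thesis by blast
  qed (use that(1,2) in blast)+
qed

lemma sphere_points_norm:
  assumes "x \<in> sphere_points"
  shows "x \<bullet> x = 1"
  using assms
proof (cases rule: sphere_points_cases)
  case (3 i j)
  then show ?thesis
    by (simp add: pair_point_doubleton inner_add_left inner_add_right inner_axis_axis)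
qed (simp_all add: inner_axis_axis)

text \<open>The linear system is triangular: the values at \<open>axis i 1\<close> and
  \<open>axis i (-1)\<close> determine \<open>l\<close> (odd part) and the diagonal of
  \<open>M\<close> (even part), after which each pair point determines one off-diagonal
  entry.\<close>

lemma sphere_points_interpolation:
  fixes t :: "real^'n \<Rightarrow> real"
  obtains M :: "real^'n^'n" and l where "transpose M = M"
    and "\<And>x. x \<in> sphere_points \<Longrightarrow> x \<bullet> (M *v x) + l \<bullet> x = t x"
proof -
  define l :: "real^'n" where "l = (\<chi> i. (t (axis i 1) - t (axis i (-1))) / 2)"
  define m where "m i = (t (axis i 1) + t (axis i (-1))) / 2" for i :: 'n
  \<comment> \<open>The off-diagonal entry solves \<open>(m i + m j) / 2 + M $ i $ j + (l $ i + l $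
    j) / sqrt 2 = t (pair_point {i, j})\<close>.\<close>
  define M :: "real^'n^'n" where
    "M = (\<chi> i j. if i = j then m i
                 else t (pair_point {i, j}) - (m i + m j) / 2 - (l $ i + l $ j) / sqrt 2)"
  have sym: "transpose M = M"
    by (auto simp: M_def transpose_def vec_eq_iff insert_commute add.commute)
  have M: "axis i r \<bullet> (M *v axis j s) = r * s * M $ i $ j" for i j r s
    by (simp add: inner_axis' matrix_vector_mult_def)
      (simp add: axis_def if_distrib[of "\<lambda>x. _ * x"] cong: if_cong)
  have "x \<bullet> (M *v x) + l \<bullet> x = t x" if x: "x \<in> sphere_points" for x
  proof -
    from x show ?thesis
    proof (cases rule: sphere_points_cases)
      case (1 i)
      then show ?thesis by (simp add: M inner_axis) (simp add: M_def m_def l_def field_simps)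
    next
      case (2 i)
      then show ?thesis by (simp add: M inner_axis) (simp add: M_def m_def l_def field_simps)
    next
      case (3 i j)
      have "x \<bullet> (M *v x) = (M $ i $ i + M $ j $ j + M $ i $ j + M $ j $ i) / 2"
        unfolding 3(2) pair_point_doubleton[OF 3(1)]
        by (simp add: M matrix_vector_mult_scaleR matrix_vector_right_distrib inner_add_left
            inner_add_right) (simp add: add_divide_distrib)
      also have "\<dots> = t x - (l $ i + l $ j) / sqrt 2"
      proof -
        have "M $ i $ i = m i" "M $ j $ j = m j"
          "M $ i $ j = t x - (m i + m j) / 2 - (l $ i + l $ j) / sqrt 2"
          "M $ j $ i = t x - (m i + m j) / 2 - (l $ i + l $ j) / sqrt 2"
          using 3 by (simp_all add: M_def insert_commute add.commute)
        then show ?thesis by argo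
      qed
      finally have "x \<bullet> (M *v x) = t x - (l $ i + l $ j) / sqrt 2" .
      moreover have "l \<bullet> x = (l $ i + l $ j) / sqrt 2"
        unfolding 3(2) pair_point_doubleton[OF 3(1)] by (simp add: inner_add_right inner_axis)
      ultimately show ?thesis by simp
    qed
  qed
  with sym show ?thesis using that by blast
qed

section \<open>Ellipsoids near the unit ball\<close>

text \<open>Completing the square, then rescaling the matrix to bring the bound back to 1.\<close>

lemma positive_definite_quadratic_is_ellipsoid:
  fixes A :: "real^'n^'n"
  assumes A: "positive_definite A"
  shows "{x. x \<bullet> (A *v x) + b \<bullet> x < 1} \<in> ellipsoids"
proof -
  have pos: "v \<bullet> (A *v v) \<ge> 0" for v
    using A by (cases "v = 0") (auto simp: positive_definite_def less_imp_le)
  have sym: "x \<bullet> (A *v y) = y \<bullet> (A *v x)" for x y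
    using A by (metis positive_definite_def dot_lmul_matrix inner_commute transpose_matrix_vector)
  have "v = 0" if "A *v v = 0" for v
    using A that unfolding positive_definite_def by (metis inner_zero_right less_irrefl)
  then have "inj ((*v) A)"
    by (simp add: linear_injective_0)
  then have "surj ((*v) A)"
    by (rule linear_injective_imp_surjective[rotated]) simp_all
  \<comment> \<open>The centre is the point where the gradient
    \<open>2 *\<^sub>R (A *v x) + b\<close> vanishes.\<close>
  then obtain \<mu> where \<mu>: "A *v \<mu> = (-1/2) *\<^sub>R b" by (metis surjD)
  \<comment> \<open>In centred form the condition reads
    \<open>(x - \<mu>) \<bullet> (A *v (x - \<mu>)) < r\<close>. Positivity of \<open>r\<close>
    allows division by it.\<close>
  define r where "r = 1 + \<mu> \<bullet> (A *v \<mu>)"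
  have r: "r > 0" unfolding r_def using pos[of \<mu>] by simp
  let ?A = "(1 / r) *\<^sub>R A"
  have mv: "?A *v v = (1 / r) *\<^sub>R (A *v v)" for v
    by (simp add: scaleR_matrix_vector_assoc)
  have "transpose ?A = ?A"
    using A by (simp add: positive_definite_def transpose_def vec_eq_iff)
  then have pd: "positive_definite ?A"
    using A r by (simp add: positive_definite_def mv)
  have square: "(x - \<mu>) \<bullet> (A *v (x - \<mu>)) = x \<bullet> (A *v x) + b \<bullet> x + (r - 1)" for x
  proof -
    have "(x - \<mu>) \<bullet> (A *v (x - \<mu>)) = x \<bullet> (A *v x) - 2 * (x \<bullet> (A *v \<mu>)) + \<mu> \<bullet> (A *v \<mu>)"
      using sym[of x \<mu>]
      by (simp add: matrix_vector_mult_diff_distrib inner_diff_left inner_diff_right)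
    also have "x \<bullet> (A *v \<mu>) = - (b \<bullet> x) / 2"
      unfolding \<mu> by (simp add: inner_commute)
    finally show ?thesis by (simp add: r_def)
  qed
  have "{x. x \<bullet> (A *v x) + b \<bullet> x < 1} = ellipsoid \<mu> ?A"
    using r by (simp add: ellipsoid_def mv square pos_divide_less_eq diff_less_0_iff_less add_diff_eq)
  with pd show ?thesis
    by (auto simp: ellipsoids_def)
qed

lemma positive_definite_perturbation:
  fixes M :: "real^'n^'n"
  assumes "transpose M = M"
  obtains e :: real where "e > 0" "positive_definite (mat 1 + e *\<^sub>R M)"
proof -
  obtain K where K: "K > 0" "\<And>v. norm (M *v v) \<le> norm v * K"
    using bounded_linear.pos_bounded[OF matrix_vector_mul_bounded_linear[of M]] by blast
  \<comment> \<open>As \<open>\<bar>v \<bullet> (M *v v)\<bar> \<le> K * (v \<bullet> v)\<close>,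
    the factor \<open>1 / (2 * K)\<close> leaves at least half of
    \<open>v \<bullet> v\<close>.\<close>
  let ?A = "mat 1 + (1 / (2 * K)) *\<^sub>R M"
  have "v \<bullet> (?A *v v) > 0" if "v \<noteq> 0" for v
  proof -
    have "\<bar>v \<bullet> (M *v v)\<bar> \<le> norm v * norm (M *v v)"
      by (rule Cauchy_Schwarz_ineq2)
    also have "\<dots> \<le> norm v * (norm v * K)"
      by (intro mult_left_mono K) simp
    also have "\<dots> = (v \<bullet> v) * K"
      by (simp add: power2_norm_eq_inner[symmetric] power2_eq_square)
    finally have "- (v \<bullet> v) * K \<le> v \<bullet> (M *v v)" by simp
    moreover have "v \<bullet> v > 0" using that by simp
    moreover have "v \<bullet> (?A *v v) = v \<bullet> v + (v \<bullet> (M *v v)) / (2 * K)"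
      by (simp add: matrix_vector_mult_add_rdistrib inner_add_right
          flip: scaleR_matrix_vector_assoc)
    moreover have "- (v \<bullet> v) / 2 \<le> (v \<bullet> (M *v v)) / (2 * K)"
      using calculation(1) K(1) by (simp add: field_simps)
    ultimately show ?thesis by linarith
  qed
  moreover have "transpose ?A = ?A"
    using assms by (auto simp: transpose_def vec_eq_iff mat_def)
  ultimately show ?thesis
    using that[of "1 / (2 * K)"] K(1) by (simp add: positive_definite_def)
qed

text \<open>On the unit sphere \<open>x \<bullet> x\<close> equals the threshold 1, so the sign of
  the interpolated perturbation, -1 on \<open>Y\<close> and 1 elsewhere, decides membership however
  small \<open>e\<close> is.\<close>

lemma ellipsoids_shatter_sphere_points:
  "shatters (ellipsoids :: (real^'n) set set) sphere_points"
  unfolding shatters_def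
proof (intro allI impI)
  fix Y :: "(real^'n) set"
  assume Y: "Y \<subseteq> sphere_points"
  obtain M :: "real^'n^'n" and l where sym: "transpose M = M"
    and ip: "\<And>x. x \<in> sphere_points \<Longrightarrow> x \<bullet> (M *v x) + l \<bullet> x = (if x \<in> Y then -1 else 1)"
    using sphere_points_interpolation[of "\<lambda>x. if x \<in> Y then -1 else 1"] by blast
  obtain e where e: "e > 0" "positive_definite (mat 1 + e *\<^sub>R M)"
    using positive_definite_perturbation[OF sym] by blast
  let ?E = "{x. x \<bullet> ((mat 1 + e *\<^sub>R M) *v x) + (e *\<^sub>R l) \<bullet> x < 1}"
  have "x \<in> ?E \<longleftrightarrow> x \<in> Y" if "x \<in> sphere_points" for x
  proof -
    have "x \<bullet> ((mat 1 + e *\<^sub>R M) *v x) + (e *\<^sub>R l) \<bullet> x = x \<bullet> x + e * (x \<bullet> (M *v x) + l \<bullet> x)"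
      by (simp add: algebra_simps flip: scaleR_matrix_vector_assoc)
    also have "\<dots> = 1 + e * (if x \<in> Y then -1 else 1)"
      using ip[OF that] sphere_points_norm[OF that] by simp
    finally show ?thesis using e(1) by simp
  qed
  then have "cuts_out ?E Y sphere_points"
    using Y unfolding cuts_out_def by blast
  then show "\<exists>B\<in>ellipsoids. cuts_out B Y sphere_points"
    using positive_definite_quadratic_is_ellipsoid[OF e(2), of "e *\<^sub>R l"] by blast
qed

section \<open>The exact VC dimension\<close>

theorem theorem1:
  shows "vc_dim (ellipsoids :: (real^'n) set set)
           = enat ((CARD('n)^2 + 3 * CARD('n)) div 2)"
proof -
  let ?N = "(CARD('n) choose 2) + 2 * CARD('n)"
  let ?C = "shattered_cards (ellipsoids :: (real^'n) set set)"
  have N: "?N \<in> ?C"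
    using finite_sphere_points card_sphere_points ellipsoids_shatter_sphere_points
    unfolding shattered_cards_def by blast
  have le: "m \<le> ?N" if "m \<in> ?C" for m
    using that card_shattered_by_ellipsoids_le unfolding shattered_cards_def by blast
  have "(GREATEST n. n \<in> ?C) = ?N"
    by (rule Greatest_equality) (use N le in auto)
  then show ?thesis
    unfolding vc_dim_def vc_formula using N le by auto
qed

end
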